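(* The statement $OTT(\mathrm{cov}K)$ is false.
   Context: $\mathrm{cov}K$ is the least cardinal $\kappa$ such that the real line can be covered by $\kappa$ many nowhere dense sets. For a cardinal $\kappa$, $OTT(\kappa)$ is the following statement: for every finite $n>2$, every countable consistent theory $T$ in $L_n$ (first order logic restricted to the first $n$ variables) whose Tarski–Lindenbaum algebra $\mathfrak{Fm}_T$ belongs to $\mathfrak{Nr}_n\mathsf{CA}_\omega$, and every family of $\kappa$ many non-principal types of $T$, there is a model of $T$ omitting all types in the family. Here a type $\Gamma$ (a set of $L_n$ formulas) is non-principal if there is no formula $\psi$ consistent with $T$ with $T\models\psi\to\phi$ for all $\phi\in\Gamma$; a model $\mathfrak M$ omits $\Gamma$ if no assignment $s\in{}^nM$ satisfies all formulas in $\Gamma$. $\mathsf{CA}_\omega$ is the class of cylindric algebras of dimension $\omega$, and $\mathfrak{Nr}_n\mathsf{CA}_\omega$ is the class of (isomorphic copies of) neat $n$-reducts $\mathfrak{Nr}_n\mathfrak B$, $\mathfrak B\in\mathsf{CA}_\omega$, where $\mathfrak{Nr}_n\mathfrak B$ has universe $\{b:c_ib=b\text{ for all }i\ge n\}$ and the operations of $\mathfrak B$ with indices $<n$. *)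

theory Defs
  imports "HOL-Analysis.Analysis"
begin

no_notation elt_set_eq (infix \<open>=o\<close> 50)
unbundle cardinal_syntax

section \<open>The cardinal cov K\<close>

definition nowhere_dense :: "'a::topological_space set \<Rightarrow> bool" where
  "nowhere_dense S \<longleftrightarrow> interior (closure S) = {}"

text \<open>Cardinals are relations satisfying \<^const>\<open>Card_order\<close>; a family of \<open>\<kappa>\<close> many objects is a
  family indexed by \<open>Field \<kappa>\<close>.\<close>

definition nwd_coverable :: "'k rel \<Rightarrow> bool" where
  "nwd_coverable \<kappa> \<longleftrightarrow> (\<exists>N :: 'k \<Rightarrow> real set.
     (\<forall>k\<in>Field \<kappa>. nowhere_dense (N k)) \<and> (\<Union>k\<in>Field \<kappa>. N k) = UNIV)"

text \<open>Only cardinals up to the continuum are compared here, which suffices because the real line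
  is covered by its singletons; see \<open>covK_least\<close> below.\<close>

definition covK :: "real rel" where
  "covK = (SOME \<kappa>. Card_order \<kappa> \<and> nwd_coverable \<kappa> \<and>
     (\<forall>\<mu>::real rel. Card_order \<mu> \<and> nwd_coverable \<mu> \<longrightarrow> \<kappa> \<le>o \<mu>))"

lemma nwd_coverable_continuum: "nwd_coverable |UNIV :: real set|"
proof -
  have "nowhere_dense {x}" for x :: real
    by (simp add: nowhere_dense_def)
  then show ?thesis
    unfolding nwd_coverable_def
    by (intro exI[of _ "\<lambda>x. {x}"]) (auto simp: Field_card_of)
qed

lemma covK_spec:
  "Card_order covK \<and> nwd_coverable covK \<and>
     (\<forall>\<mu>::real rel. Card_order \<mu> \<and> nwd_coverable \<mu> \<longrightarrow> covK \<le>o \<mu>)"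
proof -
  let ?R = "{\<kappa> :: real rel. Card_order \<kappa> \<and> nwd_coverable \<kappa>}"
  have "?R \<noteq> {}"
    using nwd_coverable_continuum card_of_Card_order by blast
  then have "\<exists>r\<in>?R. \<forall>r'\<in>?R. r \<le>o r'"
    by (intro exists_minim_Card_order) auto
  then have "\<exists>\<kappa>::real rel. Card_order \<kappa> \<and> nwd_coverable \<kappa> \<and>
     (\<forall>\<mu>::real rel. Card_order \<mu> \<and> nwd_coverable \<mu> \<longrightarrow> \<kappa> \<le>o \<mu>)"
    by blast
  then show ?thesis
    unfolding covK_def by (rule someI_ex)
qed

lemma nwd_coverable_ordIso:
  assumes "\<kappa> =o \<mu>" "nwd_coverable \<kappa>"
  shows "nwd_coverable \<mu>"
proof -
  obtain N where N: "\<forall>k\<in>Field \<kappa>. nowhere_dense (N k)" "(\<Union>k\<in>Field \<kappa>. N k) = (UNIV :: real set)"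
    using assms(2) unfolding nwd_coverable_def by blast
  obtain f where "iso \<kappa> \<mu> f"
    using assms(1) unfolding ordIso_def by auto
  then have f: "bij_betw f (Field \<kappa>) (Field \<mu>)"
    by (simp add: iso_def)
  let ?g = "inv_into (Field \<kappa>) f"
  have g: "?g ` Field \<mu> = Field \<kappa>"
    using bij_betw_inv_into[OF f] by (simp add: bij_betw_def)
  have "(\<Union>k\<in>Field \<mu>. N (?g k)) = (\<Union>k\<in>?g ` Field \<mu>. N k)"
    by auto
  moreover have "\<forall>k\<in>Field \<mu>. nowhere_dense (N (?g k))"
    using g N(1) by auto
  ultimately show ?thesis
    unfolding nwd_coverable_def using N(2) g by (intro exI[of _ "\<lambda>k. N (?g k)"]) auto
qed

lemma covK_least:
  fixes \<mu> :: "'k rel"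
  assumes "Card_order \<mu>" "nwd_coverable \<mu>"
  shows "covK \<le>o \<mu>"
proof -
  have cont: "covK \<le>o |UNIV :: real set|"
    using covK_spec nwd_coverable_continuum card_of_Card_order by blast
  have "|UNIV :: real set| \<le>o \<mu> \<or> \<mu> \<le>o |UNIV :: real set|"
    using assms(1) card_of_Well_order by (intro ordLeq_total) (auto simp: card_order_on_def)
  then show ?thesis
  proof
    assume "|UNIV :: real set| \<le>o \<mu>"
    then show ?thesis using cont ordLeq_transitive by blast
  next
    assume "\<mu> \<le>o |UNIV :: real set|"
    then obtain \<nu> :: "real rel" where \<nu>: "\<mu> =o \<nu>"
      using internalize_ordLeq[of \<mu> "|UNIV :: real set|"] by blast
    then have "Card_order \<nu>"
      using assms(1) Card_order_ordIso2 by blast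
    then have "covK \<le>o \<nu>"
      using covK_spec nwd_coverable_ordIso[OF \<nu> assms(2)] by blast
    then show ?thesis
      using \<nu> ordIso_symmetric ordLeq_ordIso_trans by blast
  qed
qed

section \<open>First order logic with finitely many variables\<close>

text \<open>Relation symbols of the (countable, relational) languages are natural numbers; variables
  \<open>x\<^sub>0, x\<^sub>1, \<dots>\<close> are represented by their indices. Equality is a logical symbol.\<close>

datatype fm =
    Rel nat "nat list"
  | Eq nat nat
  | Neg fm
  | And fm fm
  | Exists nat fm

instance fm :: countable
  by countable_datatype

definition Or :: "fm \<Rightarrow> fm \<Rightarrow> fm" where
  "Or \<phi> \<psi> = Neg (And (Neg \<phi>) (Neg \<psi>))"

definition Imp :: "fm \<Rightarrow> fm \<Rightarrow> fm" where
  "Imp \<phi> \<psi> = Neg (And \<phi> (Neg \<psi>))"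

definition Iff :: "fm \<Rightarrow> fm \<Rightarrow> fm" where
  "Iff \<phi> \<psi> = And (Imp \<phi> \<psi>) (Imp \<psi> \<phi>)"

fun free_vars :: "fm \<Rightarrow> nat set" where
  "free_vars (Rel r vs) = set vs"
| "free_vars (Eq i j) = {i, j}"
| "free_vars (Neg \<phi>) = free_vars \<phi>"
| "free_vars (And \<phi> \<psi>) = free_vars \<phi> \<union> free_vars \<psi>"
| "free_vars (Exists i \<phi>) = free_vars \<phi> - {i}"

text \<open>A signature assigns an arity to each of its relation symbols and \<^const>\<open>None\<close> to every other
  number.\<close>

type_synonym signature = "nat \<rightharpoonup> nat"

text \<open>\<open>Ln_fm n \<Sigma>\<close>: only the variables \<open>x\<^sub>0, \<dots>, x\<^bsub>n-1\<^esub>\<close> occur, free or bound.\<close>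

fun Ln_fm :: "nat \<Rightarrow> signature \<Rightarrow> fm \<Rightarrow> bool" where
  "Ln_fm n \<Sigma> (Rel r vs) \<longleftrightarrow> \<Sigma> r = Some (length vs) \<and> set vs \<subseteq> {..<n}"
| "Ln_fm n \<Sigma> (Eq i j) \<longleftrightarrow> i < n \<and> j < n"
| "Ln_fm n \<Sigma> (Neg \<phi>) \<longleftrightarrow> Ln_fm n \<Sigma> \<phi>"
| "Ln_fm n \<Sigma> (And \<phi> \<psi>) \<longleftrightarrow> Ln_fm n \<Sigma> \<phi> \<and> Ln_fm n \<Sigma> \<psi>"
| "Ln_fm n \<Sigma> (Exists i \<phi>) \<longleftrightarrow> i < n \<and> Ln_fm n \<Sigma> \<phi>"

definition Ln :: "nat \<Rightarrow> signature \<Rightarrow> fm set" where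
  "Ln n \<Sigma> = {\<phi>. Ln_fm n \<Sigma> \<phi>}"

definition Ln_theory :: "nat \<Rightarrow> signature \<Rightarrow> fm set \<Rightarrow> bool" where
  "Ln_theory n \<Sigma> T \<longleftrightarrow> T \<subseteq> Ln n \<Sigma> \<and> (\<forall>\<phi>\<in>T. free_vars \<phi> = {})"

text \<open>The values of \<open>interp\<close> on lists that are not in the domain or do not have the right length
  play no role.\<close>

record 'u struct =
  universe :: "'u set"
  interp :: "nat \<Rightarrow> 'u list set"

fun sat :: "('u, 'z) struct_scheme \<Rightarrow> (nat \<Rightarrow> 'u) \<Rightarrow> fm \<Rightarrow> bool" where
  "sat M s (Rel r vs) \<longleftrightarrow> map s vs \<in> interp M r"
| "sat M s (Eq i j) \<longleftrightarrow> s i = s j"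
| "sat M s (Neg \<phi>) \<longleftrightarrow> \<not> sat M s \<phi>"
| "sat M s (And \<phi> \<psi>) \<longleftrightarrow> sat M s \<phi> \<and> sat M s \<psi>"
| "sat M s (Exists i \<phi>) \<longleftrightarrow> (\<exists>a\<in>universe M. sat M (s(i := a)) \<phi>)"

definition assignments :: "nat \<Rightarrow> 'u struct \<Rightarrow> (nat \<Rightarrow> 'u) set" where
  "assignments n M = {..<n} \<rightarrow>\<^sub>E universe M"

definition is_model :: "nat \<Rightarrow> 'u struct \<Rightarrow> fm set \<Rightarrow> bool" where
  "is_model n M T \<longleftrightarrow> universe M \<noteq> {} \<and> (\<forall>\<phi>\<in>T. \<forall>s\<in>assignments n M. sat M s \<phi>)"

text \<open>Notions that quantify over all structures take an argument \<open>U :: 'u itself\<close>; all structures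
  (and all algebras) considered then live on subsets of the type \<open>'u\<close>, which plays the role of the
  universe of sets. For countable languages the choice of the infinite type \<open>'u\<close> is immaterial, by
  the downward Loewenheim--Skolem theorem; see \<open>OTT_universe\<close> below.\<close>

definition consistent :: "'u itself \<Rightarrow> nat \<Rightarrow> fm set \<Rightarrow> bool" where
  "consistent U n T \<longleftrightarrow> (\<exists>M :: 'u struct. is_model n M T)"

definition consistent_with :: "'u itself \<Rightarrow> nat \<Rightarrow> fm set \<Rightarrow> fm \<Rightarrow> bool" where
  "consistent_with U n T \<psi> \<longleftrightarrow>
     (\<exists>M :: 'u struct. is_model n M T \<and> (\<exists>s\<in>assignments n M. sat M s \<psi>))"

definition entails :: "'u itself \<Rightarrow> nat \<Rightarrow> fm set \<Rightarrow> fm \<Rightarrow> bool" where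
  "entails U n T \<phi> \<longleftrightarrow>
     (\<forall>M :: 'u struct. is_model n M T \<longrightarrow> (\<forall>s\<in>assignments n M. sat M s \<phi>))"

definition non_principal :: "'u itself \<Rightarrow> nat \<Rightarrow> signature \<Rightarrow> fm set \<Rightarrow> fm set \<Rightarrow> bool" where
  "non_principal U n \<Sigma> T \<Gamma> \<longleftrightarrow>
     \<not> (\<exists>\<psi>\<in>Ln n \<Sigma>. consistent_with U n T \<psi> \<and> (\<forall>\<phi>\<in>\<Gamma>. entails U n T (Imp \<psi> \<phi>)))"

definition omits :: "nat \<Rightarrow> 'u struct \<Rightarrow> fm set \<Rightarrow> bool" where
  "omits n M \<Gamma> \<longleftrightarrow> \<not> (\<exists>s\<in>assignments n M. \<forall>\<phi>\<in>\<Gamma>. sat M s \<phi>)"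

section \<open>Cylindric algebras and neat reducts\<close>

record 'a cyl_alg =
  ca_carrier :: "'a set"
  ca_join :: "'a \<Rightarrow> 'a \<Rightarrow> 'a"
  ca_meet :: "'a \<Rightarrow> 'a \<Rightarrow> 'a"
  ca_compl :: "'a \<Rightarrow> 'a"
  ca_zero :: "'a"
  ca_one :: "'a"
  cyl :: "nat \<Rightarrow> 'a \<Rightarrow> 'a"
  diag :: "nat \<Rightarrow> nat \<Rightarrow> 'a"

text \<open>Cylindric algebras whose dimension is the index set \<open>I\<close>, with the axioms of Henkin, Monk and
  Tarski; \<open>x \<le> y\<close> is expressed by \<open>x \<cdot> y = x\<close>.\<close>

locale cylindric_algebra =
  fixes I :: "nat set" and A :: "'a cyl_alg"
  assumes join_closed: "\<lbrakk>x \<in> ca_carrier A; y \<in> ca_carrier A\<rbrakk> \<Longrightarrow> ca_join A x y \<in> ca_carrier A"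
    and meet_closed: "\<lbrakk>x \<in> ca_carrier A; y \<in> ca_carrier A\<rbrakk> \<Longrightarrow> ca_meet A x y \<in> ca_carrier A"
    and compl_closed: "x \<in> ca_carrier A \<Longrightarrow> ca_compl A x \<in> ca_carrier A"
    and zero_closed: "ca_zero A \<in> ca_carrier A"
    and one_closed: "ca_one A \<in> ca_carrier A"
    and cyl_closed: "\<lbrakk>i \<in> I; x \<in> ca_carrier A\<rbrakk> \<Longrightarrow> cyl A i x \<in> ca_carrier A"
    and diag_closed: "\<lbrakk>i \<in> I; j \<in> I\<rbrakk> \<Longrightarrow> diag A i j \<in> ca_carrier A"
    and join_assoc: "\<lbrakk>x \<in> ca_carrier A; y \<in> ca_carrier A; z \<in> ca_carrier A\<rbrakk>
          \<Longrightarrow> ca_join A (ca_join A x y) z = ca_join A x (ca_join A y z)"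
    and meet_assoc: "\<lbrakk>x \<in> ca_carrier A; y \<in> ca_carrier A; z \<in> ca_carrier A\<rbrakk>
          \<Longrightarrow> ca_meet A (ca_meet A x y) z = ca_meet A x (ca_meet A y z)"
    and join_comm: "\<lbrakk>x \<in> ca_carrier A; y \<in> ca_carrier A\<rbrakk> \<Longrightarrow> ca_join A x y = ca_join A y x"
    and meet_comm: "\<lbrakk>x \<in> ca_carrier A; y \<in> ca_carrier A\<rbrakk> \<Longrightarrow> ca_meet A x y = ca_meet A y x"
    and meet_join_distrib: "\<lbrakk>x \<in> ca_carrier A; y \<in> ca_carrier A; z \<in> ca_carrier A\<rbrakk>
          \<Longrightarrow> ca_meet A x (ca_join A y z) = ca_join A (ca_meet A x y) (ca_meet A x z)"
    and join_meet_distrib: "\<lbrakk>x \<in> ca_carrier A; y \<in> ca_carrier A; z \<in> ca_carrier A\<rbrakk>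
          \<Longrightarrow> ca_join A x (ca_meet A y z) = ca_meet A (ca_join A x y) (ca_join A x z)"
    and join_zero: "x \<in> ca_carrier A \<Longrightarrow> ca_join A x (ca_zero A) = x"
    and meet_one: "x \<in> ca_carrier A \<Longrightarrow> ca_meet A x (ca_one A) = x"
    and join_compl: "x \<in> ca_carrier A \<Longrightarrow> ca_join A x (ca_compl A x) = ca_one A"
    and meet_compl: "x \<in> ca_carrier A \<Longrightarrow> ca_meet A x (ca_compl A x) = ca_zero A"
    and cyl_zero: "i \<in> I \<Longrightarrow> cyl A i (ca_zero A) = ca_zero A"
    and cyl_increasing: "\<lbrakk>i \<in> I; x \<in> ca_carrier A\<rbrakk> \<Longrightarrow> ca_meet A x (cyl A i x) = x"
    and cyl_meet_cyl: "\<lbrakk>i \<in> I; x \<in> ca_carrier A; y \<in> ca_carrier A\<rbrakk>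
          \<Longrightarrow> cyl A i (ca_meet A x (cyl A i y)) = ca_meet A (cyl A i x) (cyl A i y)"
    and cyl_commute: "\<lbrakk>i \<in> I; j \<in> I; x \<in> ca_carrier A\<rbrakk>
          \<Longrightarrow> cyl A i (cyl A j x) = cyl A j (cyl A i x)"
    and diag_refl: "i \<in> I \<Longrightarrow> diag A i i = ca_one A"
    and diag_cyl: "\<lbrakk>i \<in> I; j \<in> I; k \<in> I; k \<noteq> i; k \<noteq> j\<rbrakk>
          \<Longrightarrow> diag A i j = cyl A k (ca_meet A (diag A i k) (diag A k j))"
    and diag_unique: "\<lbrakk>i \<in> I; j \<in> I; i \<noteq> j; x \<in> ca_carrier A\<rbrakk>
          \<Longrightarrow> ca_meet A (cyl A i (ca_meet A (diag A i j) x))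
                  (cyl A i (ca_meet A (diag A i j) (ca_compl A x))) = ca_zero A"

abbreviation CA_omega :: "'a cyl_alg \<Rightarrow> bool" where
  "CA_omega \<equiv> cylindric_algebra UNIV"

text \<open>The operations with indices \<open>\<ge> n\<close> are still present in the record \<open>neat_reduct n B\<close>, but
  \<open>cyl_iso n\<close> below ignores them.\<close>

definition neat_reduct :: "nat \<Rightarrow> 'a cyl_alg \<Rightarrow> 'a cyl_alg" where
  "neat_reduct n B = B\<lparr>ca_carrier := {b \<in> ca_carrier B. \<forall>i\<ge>n. cyl B i b = b}\<rparr>"

definition cyl_iso :: "nat \<Rightarrow> 'a cyl_alg \<Rightarrow> 'b cyl_alg \<Rightarrow> ('a \<Rightarrow> 'b) \<Rightarrow> bool" where
  "cyl_iso n A B h \<longleftrightarrow>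
     bij_betw h (ca_carrier A) (ca_carrier B) \<and>
     (\<forall>x\<in>ca_carrier A. \<forall>y\<in>ca_carrier A. h (ca_join A x y) = ca_join B (h x) (h y)) \<and>
     (\<forall>x\<in>ca_carrier A. \<forall>y\<in>ca_carrier A. h (ca_meet A x y) = ca_meet B (h x) (h y)) \<and>
     (\<forall>x\<in>ca_carrier A. h (ca_compl A x) = ca_compl B (h x)) \<and>
     h (ca_zero A) = ca_zero B \<and> h (ca_one A) = ca_one B \<and>
     (\<forall>i<n. \<forall>x\<in>ca_carrier A. h (cyl A i x) = cyl B i (h x)) \<and>
     (\<forall>i<n. \<forall>j<n. h (diag A i j) = diag B i j)"

definition in_Nr_CA_omega :: "'u itself \<Rightarrow> nat \<Rightarrow> 'a cyl_alg \<Rightarrow> bool" where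
  "in_Nr_CA_omega U n A \<longleftrightarrow>
     (\<exists>(B :: 'u cyl_alg) h. CA_omega B \<and> cyl_iso n A (neat_reduct n B) h)"

section \<open>The Tarski--Lindenbaum algebra\<close>

definition TL_rel :: "'u itself \<Rightarrow> nat \<Rightarrow> signature \<Rightarrow> fm set \<Rightarrow> fm rel" where
  "TL_rel U n \<Sigma> T = {(\<phi>, \<psi>). \<phi> \<in> Ln n \<Sigma> \<and> \<psi> \<in> Ln n \<Sigma> \<and> entails U n T (Iff \<phi> \<psi>)}"

text \<open>The unions range over the representatives of the given classes; the classes united are all
  equal.\<close>

definition TL_alg :: "'u itself \<Rightarrow> nat \<Rightarrow> signature \<Rightarrow> fm set \<Rightarrow> fm set cyl_alg" where
  "TL_alg U n \<Sigma> T = (let E = TL_rel U n \<Sigma> T in \<lparr>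
     ca_carrier = Ln n \<Sigma> // E,
     ca_join = (\<lambda>X Y. \<Union>\<phi>\<in>X. \<Union>\<psi>\<in>Y. E `` {Or \<phi> \<psi>}),
     ca_meet = (\<lambda>X Y. \<Union>\<phi>\<in>X. \<Union>\<psi>\<in>Y. E `` {And \<phi> \<psi>}),
     ca_compl = (\<lambda>X. \<Union>\<phi>\<in>X. E `` {Neg \<phi>}),
     ca_zero = E `` {Neg (Eq 0 0)},
     ca_one = E `` {Eq 0 0},
     cyl = (\<lambda>i X. \<Union>\<phi>\<in>X. E `` {Exists i \<phi>}),
     diag = (\<lambda>i j. E `` {Eq i j})\<rparr>)"

section \<open>The omitting types statement\<close>

definition OTT :: "'u itself \<Rightarrow> 'k rel \<Rightarrow> bool" where
  "OTT U \<kappa> \<longleftrightarrow>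
     (\<forall>n>2. \<forall>\<Sigma> T. Ln_theory n \<Sigma> T \<and> consistent U n T \<and> in_Nr_CA_omega U n (TL_alg U n \<Sigma> T) \<longrightarrow>
       (\<forall>\<Gamma> :: 'k \<Rightarrow> fm set.
          (\<forall>k\<in>Field \<kappa>. \<Gamma> k \<subseteq> Ln n \<Sigma> \<and> non_principal U n \<Sigma> T (\<Gamma> k)) \<longrightarrow>
          (\<exists>M :: 'u struct. is_model n M T \<and> (\<forall>k\<in>Field \<kappa>. omits n M (\<Gamma> k)))))"

section \<open>Independence of the universe\<close>

lemma downward_LS:
  fixes M :: "'u struct"
  assumes inf: "infinite (UNIV :: 'v set)"
    and ne: "universe M \<noteq> {}"
    and s0: "s0 \<in> assignments n M"
  obtains N :: "'v struct" and g :: "'v \<Rightarrow> 'u" and t0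
  where "universe N \<noteq> {}"
    and "\<And>t. t \<in> assignments n N \<Longrightarrow> (\<lambda>i\<in>{..<n}. g (t i)) \<in> assignments n M"
    and "t0 \<in> assignments n N"
    and "(\<lambda>i\<in>{..<n}. g (t0 i)) = s0"
    and "\<And>\<Sigma> \<phi> t. \<lbrakk>Ln_fm n \<Sigma> \<phi>; t \<in> assignments n N\<rbrakk>
           \<Longrightarrow> sat N t \<phi> \<longleftrightarrow> sat M (\<lambda>i\<in>{..<n}. g (t i)) \<phi>"
proof -
  obtain a0 where a0: "a0 \<in> universe M" using ne by blast
  define w where "w = (\<lambda>i \<phi> s. if \<exists>a\<in>universe M. sat M (s(i := a)) \<phi>
    then SOME a. a \<in> universe M \<and> sat M (s(i := a)) \<phi> else a0)"
  have w: "w i \<phi> s \<in> universe M" for i \<phi> s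
  proof (cases "\<exists>a\<in>universe M. sat M (s(i := a)) \<phi>")
    case True
    then have "\<exists>a. a \<in> universe M \<and> sat M (s(i := a)) \<phi>" by blast
    from someI_ex[OF this] show ?thesis using True by (simp add: w_def)
  qed (simp add: w_def a0)
  have w_sat: "sat M (s(i := w i \<phi> s)) \<phi>" if "\<exists>a\<in>universe M. sat M (s(i := a)) \<phi>" for i \<phi> s
  proof -
    have "\<exists>a. a \<in> universe M \<and> sat M (s(i := a)) \<phi>" using that by blast
    from someI_ex[OF this] show ?thesis using that by (simp add: w_def)
  qed
  define F where "F = (\<lambda>D. D \<union> (\<lambda>(i, \<phi>, s). w i \<phi> s) ` (UNIV \<times> UNIV \<times> ({..<n} \<rightarrow>\<^sub>E D)))"
  define D where "D = (\<lambda>k. (F ^^ k) (insert a0 (s0 ` {..<n})))"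
  define E where "E = (\<Union>k. D k)"
  have DS: "D (Suc k) = F (D k)" for k
    by (simp add: D_def)
  have D_count: "countable (D k)" for k
  proof (induction k)
    case 0 show ?case by (simp add: D_def)
  next
    case (Suc k)
    then have "countable ({..<n} \<rightarrow>\<^sub>E D k)"
      by (intro countable_PiE) auto
    then show ?case
      unfolding DS F_def using Suc by auto
  qed
  have D_sub: "D k \<subseteq> universe M" for k
  proof (induction k)
    case 0 show ?case using a0 s0 by (auto simp: D_def assignments_def)
  next
    case (Suc k) then show ?case unfolding DS F_def using w by auto
  qed
  have D_mono: "D j \<subseteq> D k" if "j \<le> k" for j k
    using that by (rule lift_Suc_mono_le[rotated]) (auto simp: DS F_def)
  have E_count: "countable E" unfolding E_def using D_count by auto
  have E_sub: "E \<subseteq> universe M" unfolding E_def using D_sub by auto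
  have D0: "insert a0 (s0 ` {..<n}) \<subseteq> E"
  proof -
    have "D 0 \<subseteq> E" by (auto simp: E_def)
    then show ?thesis by (simp add: D_def)
  qed
  have E_closed: "w i \<phi> s \<in> E" if s: "s \<in> {..<n} \<rightarrow>\<^sub>E E" for i \<phi> s
  proof -
    have "\<forall>j\<in>{..<n}. \<exists>k. s j \<in> D k"
      using s by (auto simp: E_def PiE_def Pi_def)
    then obtain k where k: "\<forall>j\<in>{..<n}. s j \<in> D (k j)"
      by metis
    define m where "m = Max (insert 0 (k ` {..<n}))"
    have "k j \<le> m" if "j < n" for j
      unfolding m_def using that by (intro Max_ge) auto
    then have "s j \<in> D m" if "j < n" for j
      using that k D_mono by blast
    then have "s \<in> {..<n} \<rightarrow>\<^sub>E D m"
      using s by (auto simp: PiE_def Pi_def)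
    then have "w i \<phi> s \<in> D (Suc m)"
      unfolding DS F_def by force
    then show ?thesis by (auto simp: E_def)
  qed
  obtain e :: "nat \<Rightarrow> 'v" where e: "inj e"
    using infinite_countable_subset[OF inf] by blast
  define f where "f = e \<circ> to_nat_on E"
  have f: "inj_on f E"
    unfolding f_def using e E_count
    by (meson comp_inj_on inj_on_subset inj_on_to_nat_on subset_UNIV)
  define g where "g = inv_into E f"
  have gf: "g (f a) = a" if "a \<in> E" for a
    unfolding g_def using f that by simp
  have fg: "f (g b) = b" and g_in: "g b \<in> E" if "b \<in> f ` E" for b
    unfolding g_def using that by (auto simp: f_inv_into_f inv_into_into)
  define N :: "'v struct" where "N = \<lparr>universe = f ` E, interp = \<lambda>r. {ys. map g ys \<in> interp M r}\<rparr>"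
  have uN: "universe N = f ` E" by (simp add: N_def)
  have g_asg: "(\<lambda>i\<in>{..<n}. g (t i)) \<in> {..<n} \<rightarrow>\<^sub>E E" if "t \<in> assignments n N" for t
    using that g_in by (auto simp: assignments_def uN PiE_def Pi_def)
  have sat: "sat N t \<phi> \<longleftrightarrow> sat M (\<lambda>i\<in>{..<n}. g (t i)) \<phi>"
    if "Ln_fm n \<Sigma> \<phi>" "t \<in> assignments n N" for \<Sigma> \<phi> t
    using that
  proof (induction \<phi> arbitrary: t)
    case (Rel r vs)
    have "map g (map t vs) = map (\<lambda>i\<in>{..<n}. g (t i)) vs"
      using Rel.prems(1) by auto
    then show ?case by (simp only: sat.simps N_def struct.simps mem_Collect_eq)
  next
    case (Eq i j)
    then have "t i \<in> f ` E" "t j \<in> f ` E" "i < n" "j < n"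
      by (auto simp: assignments_def uN PiE_def Pi_def)
    moreover from this have "g (t i) = g (t j) \<longleftrightarrow> t i = t j"
      by (metis fg)
    ultimately show ?case by simp
  next
    case (Exists i \<phi>)
    let ?s = "\<lambda>i\<in>{..<n}. g (t i)"
    have i: "i < n" and \<phi>: "Ln_fm n \<Sigma> \<phi>" using Exists.prems by auto
    have upd: "(\<lambda>j\<in>{..<n}. g ((t(i := b)) j)) = ?s(i := g b)" for b
      using i by (auto simp: restrict_def fun_eq_iff)
    have IH: "sat N (t(i := b)) \<phi> \<longleftrightarrow> sat M (?s(i := g b)) \<phi>" if "b \<in> f ` E" for b
    proof -
      have "t(i := b) \<in> assignments n N"
        using Exists.prems(2) that i unfolding assignments_def uN
        by (auto simp: PiE_def Pi_def extensional_def)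
      from Exists.IH[OF \<phi> this] show ?thesis by (simp only: upd)
    qed
    show ?case
    proof
      assume "sat N t (Exists i \<phi>)"
      then obtain b where "b \<in> f ` E" "sat N (t(i := b)) \<phi>" by (auto simp: uN)
      then show "sat M ?s (Exists i \<phi>)"
        using IH g_in E_sub by auto
    next
      assume "sat M ?s (Exists i \<phi>)"
      then have "sat M (?s(i := w i \<phi> ?s)) \<phi>"
        by (intro w_sat) simp
      moreover have "w i \<phi> ?s \<in> E"
        using E_closed g_asg Exists.prems(2) by blast
      ultimately show "sat N t (Exists i \<phi>)"
        using IH[of "f (w i \<phi> ?s)"] gf by (auto simp: uN)
    qed
  qed auto
  define t0 where "t0 = (\<lambda>i\<in>{..<n}. f (s0 i))"
  have t0: "t0 \<in> assignments n N"
    using D0 by (auto simp: t0_def assignments_def uN)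
  have "(\<lambda>i\<in>{..<n}. g (t0 i)) = s0"
  proof
    fix i show "(\<lambda>i\<in>{..<n}. g (t0 i)) i = s0 i"
      using D0 gf s0 by (cases "i < n") (auto simp: t0_def assignments_def PiE_def extensional_def)
  qed
  moreover have "(\<lambda>i\<in>{..<n}. g (t i)) \<in> assignments n M" if "t \<in> assignments n N" for t
    using g_asg[OF that] E_sub by (auto simp: assignments_def PiE_def Pi_def)
  moreover have "universe N \<noteq> {}" using D0 by (auto simp: uN)
  ultimately show ?thesis using that t0 sat by blast
qed

lemma model_universe:
  fixes M :: "'u struct"
  assumes inf: "infinite (UNIV :: 'v set)"
    and T: "T \<subseteq> Ln n \<Sigma>" and M: "is_model n M T" and s0: "s0 \<in> assignments n M"
  obtains N :: "'v struct" and t0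
  where "is_model n N T" "t0 \<in> assignments n N"
    and "\<And>\<phi>. \<phi> \<in> Ln n \<Sigma> \<Longrightarrow> sat N t0 \<phi> \<longleftrightarrow> sat M s0 \<phi>"
    and "\<And>\<Gamma>. \<lbrakk>\<Gamma> \<subseteq> Ln n \<Sigma>; omits n M \<Gamma>\<rbrakk> \<Longrightarrow> omits n N \<Gamma>"
proof -
  have ne: "universe M \<noteq> {}" using M by (simp add: is_model_def)
  obtain N :: "'v struct" and g t0 where N: "universe N \<noteq> {}"
    "\<And>t. t \<in> assignments n N \<Longrightarrow> (\<lambda>i\<in>{..<n}. g (t i)) \<in> assignments n M"
    "t0 \<in> assignments n N" "(\<lambda>i\<in>{..<n}. g (t0 i)) = s0"
    "\<And>\<Sigma> \<phi> t. \<lbrakk>Ln_fm n \<Sigma> \<phi>; t \<in> assignments n N\<rbrakk>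
           \<Longrightarrow> sat N t \<phi> \<longleftrightarrow> sat M (\<lambda>i\<in>{..<n}. g (t i)) \<phi>"
    using downward_LS[OF inf ne s0] by metis
  have sat: "sat N t \<phi> \<longleftrightarrow> sat M (\<lambda>i\<in>{..<n}. g (t i)) \<phi>"
    if "\<phi> \<in> Ln n \<Sigma>" "t \<in> assignments n N" for \<phi> t
    using N(5) that by (auto simp: Ln_def)
  have "is_model n N T"
    using M N(1,2) sat T unfolding is_model_def by blast
  moreover have "omits n N \<Gamma>" if "\<Gamma> \<subseteq> Ln n \<Sigma>" "omits n M \<Gamma>" for \<Gamma>
    using that sat N(2) unfolding omits_def by blast
  ultimately show ?thesis
    using that N(3,4) sat by metis
qed

lemma assignments_nonempty: "universe M \<noteq> {} \<Longrightarrow> assignments n M \<noteq> {}"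
  by (simp add: assignments_def PiE_eq_empty_iff)

lemma consistent_with_mono:
  assumes "infinite (UNIV :: 'v set)" "T \<subseteq> Ln n \<Sigma>" "\<psi> \<in> Ln n \<Sigma>"
    and "consistent_with TYPE('u) n T \<psi>"
  shows "consistent_with TYPE('v) n T \<psi>"
proof -
  obtain M :: "'u struct" and s where M: "is_model n M T" "s \<in> assignments n M" "sat M s \<psi>"
    using assms(4) unfolding consistent_with_def by blast
  obtain N :: "'v struct" and t where "is_model n N T" "t \<in> assignments n N"
    "\<And>\<phi>. \<phi> \<in> Ln n \<Sigma> \<Longrightarrow> sat N t \<phi> \<longleftrightarrow> sat M s \<phi>"
    using model_universe[OF assms(1,2) M(1,2)] by metis
  then show ?thesis
    unfolding consistent_with_def using M(3) assms(3) by blast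
qed

lemma entails_iff: "entails U n T \<phi> \<longleftrightarrow> \<not> consistent_with U n T (Neg \<phi>)"
  by (auto simp: entails_def consistent_with_def)

lemma consistent_iff: "0 < n \<Longrightarrow> consistent U n T \<longleftrightarrow> consistent_with U n T (Eq 0 0)"
  unfolding consistent_def consistent_with_def is_model_def
  using assignments_nonempty by fastforce

lemma in_Ln_simps:
  "Neg \<phi> \<in> Ln n \<Sigma> \<longleftrightarrow> \<phi> \<in> Ln n \<Sigma>"
  "Imp \<phi> \<psi> \<in> Ln n \<Sigma> \<longleftrightarrow> \<phi> \<in> Ln n \<Sigma> \<and> \<psi> \<in> Ln n \<Sigma>"
  "Iff \<phi> \<psi> \<in> Ln n \<Sigma> \<longleftrightarrow> \<phi> \<in> Ln n \<Sigma> \<and> \<psi> \<in> Ln n \<Sigma>"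
  "Eq i j \<in> Ln n \<Sigma> \<longleftrightarrow> i < n \<and> j < n"
  by (auto simp: Ln_def Imp_def Iff_def)

datatype ca_term =
    Gen nat | Join ca_term ca_term | Meet ca_term ca_term | Compl ca_term | Zero | One
  | Cyl nat ca_term | Diag nat nat

instance ca_term :: countable
  by countable_datatype

fun ca_eval :: "'a cyl_alg \<Rightarrow> (nat \<Rightarrow> 'a) \<Rightarrow> ca_term \<Rightarrow> 'a" where
  "ca_eval B v (Gen k) = v k"
| "ca_eval B v (Join x y) = ca_join B (ca_eval B v x) (ca_eval B v y)"
| "ca_eval B v (Meet x y) = ca_meet B (ca_eval B v x) (ca_eval B v y)"
| "ca_eval B v (Compl x) = ca_compl B (ca_eval B v x)"
| "ca_eval B v Zero = ca_zero B"
| "ca_eval B v One = ca_one B"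
| "ca_eval B v (Cyl i x) = cyl B i (ca_eval B v x)"
| "ca_eval B v (Diag i j) = diag B i j"

lemma in_Nr_CA_omega_mono:
  fixes A :: "'a cyl_alg"
  assumes inf: "infinite (UNIV :: 'v set)" and cA: "countable (ca_carrier A)"
    and zA: "ca_zero A \<in> ca_carrier A"
    and Nr: "in_Nr_CA_omega TYPE('u) n A"
  shows "in_Nr_CA_omega TYPE('v) n A"
proof -
  obtain B :: "'u cyl_alg" and h where B: "CA_omega B" and h: "cyl_iso n A (neat_reduct n B) h"
    using Nr unfolding in_Nr_CA_omega_def by blast
  interpret B: cylindric_algebra UNIV B by (rule B)
  define X where "X = h ` ca_carrier A"
  have X: "X = {b \<in> ca_carrier B. \<forall>i\<ge>n. cyl B i b = b}"
    using h by (auto simp: X_def cyl_iso_def bij_betw_def neat_reduct_def)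
  have Xne: "X \<noteq> {}" and Xc: "countable X"
    using zA cA by (auto simp: X_def)
  define v where "v = from_nat_into X"
  have rv: "range v = X" unfolding v_def using Xne Xc by simp
  define C where "C = range (ca_eval B v)"
  have C_count: "countable C" by (simp add: C_def)
  have XC: "X \<subseteq> C"
  proof -
    have "v k \<in> C" for k
      unfolding C_def by (metis ca_eval.simps(1) rangeI)
    then show ?thesis unfolding rv[symmetric] by blast
  qed
  have "ca_eval B v x \<in> ca_carrier B" for x
  proof (induction x)
    case (Gen k)
    have "v k \<in> X" using rv by blast
    then show ?case by (simp add: X)
  qed (auto intro: B.join_closed B.meet_closed B.compl_closed B.zero_closed B.one_closed
        B.cyl_closed B.diag_closed)
  then have CB: "a \<in> ca_carrier B" if "a \<in> C" for a using that by (auto simp: C_def)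
  have C_I: "ca_eval B v t \<in> C" for t by (simp add: C_def)
  have C_E: "\<exists>t. a = ca_eval B v t" if "a \<in> C" for a using that by (auto simp: C_def)
  have C_join: "ca_join B a b \<in> C" and C_meet: "ca_meet B a b \<in> C"
    if ab: "a \<in> C" "b \<in> C" for a b
  proof -
    obtain s t where "a = ca_eval B v s" "b = ca_eval B v t"
      using ab C_E by blast
    then show "ca_join B a b \<in> C" "ca_meet B a b \<in> C"
      using C_I[of "Join s t"] C_I[of "Meet s t"] by simp_all
  qed
  have C_compl: "ca_compl B a \<in> C" and C_cyl: "cyl B i a \<in> C" if a: "a \<in> C" for a i
  proof -
    obtain t where "a = ca_eval B v t"
      using a C_E by blast
    then show "ca_compl B a \<in> C" "cyl B i a \<in> C"
      using C_I[of "Compl t"] C_I[of "Cyl i t"] by simp_all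
  qed
  have C_const: "ca_zero B \<in> C" "ca_one B \<in> C" "diag B i j \<in> C" for i j
    using C_I[of Zero] C_I[of One] C_I[of "Diag i j"] by simp_all
  note closed = C_join C_meet C_compl C_cyl C_const
  obtain e :: "nat \<Rightarrow> 'v" where e: "inj e"
    using infinite_countable_subset[OF inf] by blast
  define f where "f = e \<circ> to_nat_on C"
  have f: "inj_on f C"
    unfolding f_def using e C_count
    by (meson comp_inj_on inj_on_subset inj_on_to_nat_on subset_UNIV)
  define g where "g = inv_into C f"
  have gf: "g (f a) = a" if "a \<in> C" for a
    unfolding g_def using f that by simp
  define B' :: "'v cyl_alg" where "B' = \<lparr>ca_carrier = f ` C,
     ca_join = \<lambda>x y. f (ca_join B (g x) (g y)), ca_meet = \<lambda>x y. f (ca_meet B (g x) (g y)),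
     ca_compl = \<lambda>x. f (ca_compl B (g x)), ca_zero = f (ca_zero B), ca_one = f (ca_one B),
     cyl = \<lambda>i x. f (cyl B i (g x)), diag = \<lambda>i j. f (diag B i j)\<rparr>"
  have "CA_omega B'"
    by (rule cylindric_algebra.intro; (elim imageE)?; (hypsubst)?;
        simp only: B'_def cyl_alg.simps; (elim imageE)?; (hypsubst)?; (simp only: gf closed)?;
        ((intro imageI closed; assumption) |
         (rule arg_cong[of _ _ f],
          (rule B.join_assoc B.meet_assoc B.join_comm B.meet_comm B.meet_join_distrib
             B.join_meet_distrib B.join_zero B.meet_one B.join_compl B.meet_compl B.cyl_zero
             B.cyl_increasing B.cyl_meet_cyl B.cyl_commute B.diag_refl B.diag_cyl B.diag_unique;
           (assumption | rule UNIV_I | rule CB, assumption)))))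
  moreover have "cyl_iso n A (neat_reduct n B') (f \<circ> h)"
  proof -
    have hC: "h x \<in> C" if "x \<in> ca_carrier A" for x using that XC by (auto simp: X_def)
    have fX: "f ` X = {b \<in> f ` C. \<forall>i\<ge>n. f (cyl B i (g b)) = b}"
    proof -
      have "(\<forall>i\<ge>n. f (cyl B i (g (f a))) = f a) \<longleftrightarrow> a \<in> X" if "a \<in> C" for a
        using that C_cyl f CB by (auto simp: gf X inj_on_eq_iff)
      then show ?thesis using XC by blast
    qed
    have "bij_betw h (ca_carrier A) X"
      using h by (auto simp: X_def cyl_iso_def bij_betw_def)
    moreover have "bij_betw f X (f ` X)"
      using f XC by (meson bij_betw_imageI inj_on_subset)
    ultimately have "bij_betw (f \<circ> h) (ca_carrier A) (f ` X)"
      by (rule bij_betw_trans)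
    then show ?thesis
      using h hC unfolding cyl_iso_def by (simp add: neat_reduct_def B'_def fX gf)
  qed
  ultimately show ?thesis unfolding in_Nr_CA_omega_def by blast
qed

lemma OTT_mono:
  assumes inf_u: "infinite (UNIV :: 'u set)" and inf_v: "infinite (UNIV :: 'v set)"
    and O: "OTT TYPE('u) \<kappa>"
  shows "OTT TYPE('v) \<kappa>"
  unfolding OTT_def
proof (intro allI impI, elim conjE)
  fix n \<Sigma> T \<Gamma>
  assume n: "(2::nat) < n" and th: "Ln_theory n \<Sigma> T" and con: "consistent TYPE('v) n T"
    and Nr: "in_Nr_CA_omega TYPE('v) n (TL_alg TYPE('v) n \<Sigma> T)"
    and \<Gamma>: "\<forall>k\<in>Field \<kappa>. \<Gamma> k \<subseteq> Ln n \<Sigma> \<and> non_principal TYPE('v) n \<Sigma> T (\<Gamma> k)"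
  have T: "T \<subseteq> Ln n \<Sigma>" using th by (simp add: Ln_theory_def)
  have cw: "consistent_with TYPE('v) n T \<psi> \<longleftrightarrow> consistent_with TYPE('u) n T \<psi>"
    if "\<psi> \<in> Ln n \<Sigma>" for \<psi>
    using consistent_with_mono[OF inf_u T that] consistent_with_mono[OF inf_v T that] by blast
  have ent: "entails TYPE('v) n T \<psi> \<longleftrightarrow> entails TYPE('u) n T \<psi>" if "\<psi> \<in> Ln n \<Sigma>" for \<psi>
    using that by (simp add: entails_iff cw in_Ln_simps)
  have rel: "TL_rel TYPE('v) n \<Sigma> T = TL_rel TYPE('u) n \<Sigma> T"
    by (auto simp: TL_rel_def ent in_Ln_simps)
  have TL: "TL_alg TYPE('v) n \<Sigma> T = TL_alg TYPE('u) n \<Sigma> T"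
    by (simp add: TL_alg_def rel)
  have "consistent TYPE('u) n T"
    using con n cw by (simp add: consistent_iff[OF order_less_trans[OF _ n]] in_Ln_simps)
  moreover have "in_Nr_CA_omega TYPE('u) n (TL_alg TYPE('u) n \<Sigma> T)"
  proof (rule in_Nr_CA_omega_mono[OF inf_u])
    show "countable (ca_carrier (TL_alg TYPE('u) n \<Sigma> T))"
      by (auto simp: TL_alg_def Let_def quotient_def)
    have "Neg (Eq 0 0) \<in> Ln n \<Sigma>" using n by (simp add: in_Ln_simps)
    then show "ca_zero (TL_alg TYPE('u) n \<Sigma> T) \<in> ca_carrier (TL_alg TYPE('u) n \<Sigma> T)"
      by (simp add: TL_alg_def Let_def quotientI)
    show "in_Nr_CA_omega TYPE('v) n (TL_alg TYPE('u) n \<Sigma> T)"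
      using Nr by (simp add: TL)
  qed
  moreover have "\<forall>k\<in>Field \<kappa>. \<Gamma> k \<subseteq> Ln n \<Sigma> \<and> non_principal TYPE('u) n \<Sigma> T (\<Gamma> k)"
  proof (intro ballI conjI)
    fix k assume k: "k \<in> Field \<kappa>"
    then show sub: "\<Gamma> k \<subseteq> Ln n \<Sigma>" using \<Gamma> by blast
    have "consistent_with TYPE('v) n T \<psi> \<and> (\<forall>\<phi>\<in>\<Gamma> k. entails TYPE('v) n T (Imp \<psi> \<phi>)) \<longleftrightarrow>
      consistent_with TYPE('u) n T \<psi> \<and> (\<forall>\<phi>\<in>\<Gamma> k. entails TYPE('u) n T (Imp \<psi> \<phi>))"
      if "\<psi> \<in> Ln n \<Sigma>" for \<psi>
    proof -
      have "Imp \<psi> \<phi> \<in> Ln n \<Sigma>" if "\<phi> \<in> \<Gamma> k" for \<phi>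
        using sub that \<open>\<psi> \<in> Ln n \<Sigma>\<close> by (auto simp: in_Ln_simps)
      then have "entails TYPE('v) n T (Imp \<psi> \<phi>) \<longleftrightarrow> entails TYPE('u) n T (Imp \<psi> \<phi>)"
        if "\<phi> \<in> \<Gamma> k" for \<phi>
        using ent that by blast
      then show ?thesis using cw[OF that] by simp
    qed
    then show "non_principal TYPE('u) n \<Sigma> T (\<Gamma> k)"
      using \<Gamma> k unfolding non_principal_def by blast
  qed
  ultimately have "\<exists>M :: 'u struct. is_model n M T \<and> (\<forall>k\<in>Field \<kappa>. omits n M (\<Gamma> k))"
    using O[unfolded OTT_def, rule_format, OF n, of \<Sigma> T \<Gamma>] th by simp
  then obtain M :: "'u struct"
    where M: "is_model n M T" "\<forall>k\<in>Field \<kappa>. omits n M (\<Gamma> k)"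
    by blast
  then have "assignments n M \<noteq> {}"
    by (intro assignments_nonempty) (simp add: is_model_def)
  then obtain s where "s \<in> assignments n M" by blast
  then obtain N :: "'v struct" where "is_model n N T"
    "\<And>\<Gamma>. \<lbrakk>\<Gamma> \<subseteq> Ln n \<Sigma>; omits n M \<Gamma>\<rbrakk> \<Longrightarrow> omits n N \<Gamma>"
    using model_universe[OF inf_v T M(1)] by metis
  then show "\<exists>M :: 'v struct. is_model n M T \<and> (\<forall>k\<in>Field \<kappa>. omits n M (\<Gamma> k))"
    using M(2) \<Gamma> by blast
qed

theorem OTT_universe:
  assumes "infinite (UNIV :: 'u set)" and "infinite (UNIV :: 'v set)"
  shows "OTT TYPE('u) \<kappa> \<longleftrightarrow> OTT TYPE('v) \<kappa>"
  using OTT_mono[OF assms] OTT_mono[OF assms(2,1)] by (rule iffI)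

end

theory Submission
  imports Defs
begin

text \<open>
  Let \<open>T\<close> say that the universe is a singleton, in a language with infinitely many relation symbols
  of arity \<open>0\<close>. Over \<open>T\<close> every formula is a propositional one, so all cylindrifications are trivial
  on the Tarski--Lindenbaum algebra; letting the missing ones be trivial as well turns the algebra
  into a \<open>CA\<^sub>\<omega>\<close> that is its own neat reduct. A model of \<open>T\<close> is a point of the Cantor space, hence by
  binary expansion it names a real in \<open>[0, 1]\<close>. A nowhere dense set \<open>N\<close> of reals gives the type of
  all formulas true at each point that names an element of \<open>N\<close>. It is non-principal, because every
  basic clopen set contains a smaller one whose points name no element of \<open>N\<close>, and it is realized in
  each model that names an element of \<open>N\<close>. If the sets \<open>N\<close> cover the line, every model realizes one
  of the types.
\<close>

section \<open>Binary expansions\<close>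

definition binary :: "(nat \<Rightarrow> bool) \<Rightarrow> real" where
  "binary x = (\<Sum>i. of_bool (x i) * (1/2) ^ Suc i)"

lemma summable_binary: "summable (\<lambda>i. of_bool (x i) * (1/2 :: real) ^ Suc i)"
  by (rule summable_comparison_test'[where g = "\<lambda>i. (1/2) ^ Suc i" and N = 0])
    (auto simp: summable_geometric)

lemma binary_bounds: "0 \<le> binary x" "binary x \<le> 1"
proof -
  show "0 \<le> binary x"
    unfolding binary_def by (intro suminf_nonneg summable_binary) auto
  have "binary x \<le> (\<Sum>i. (1/2) ^ Suc i)"
    unfolding binary_def by (intro suminf_le summable_binary) (auto simp: summable_geometric)
  also have "\<dots> = 1"
    using power_half_series by (simp add: sums_iff)
  finally show "binary x \<le> 1" .
qed

lemma binary_split: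
  "binary x = (\<Sum>i<m. of_bool (x i) * (1/2) ^ Suc i) + (1/2) ^ m * binary (\<lambda>i. x (i + m))"
proof -
  have "(\<Sum>i. of_bool (x (i + m)) * (1/2 :: real) ^ Suc (i + m))
      = (\<Sum>i. (1/2) ^ m * (of_bool (x (i + m)) * (1/2) ^ Suc i))"
    by (simp add: power_add mult_ac)
  also have "\<dots> = (1/2) ^ m * binary (\<lambda>i. x (i + m))"
    unfolding binary_def by (intro suminf_mult summable_binary)
  finally show ?thesis
    unfolding binary_def
    by (subst suminf_split_initial_segment[OF summable_binary, of _ m]) simp
qed

text \<open>Common digits cancel in \<open>binary_split\<close>; what remains is
  \<open>(1/2) ^ m\<close> times a difference of two numbers in [0, 1].\<close>

lemma binary_close:
  assumes "\<forall>i<m. x i = y i"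
  shows "\<bar>binary x - binary y\<bar> \<le> (1/2) ^ m"
proof -
  have "binary x - binary y
      = (1/2) ^ m * (binary (\<lambda>i. x (i + m)) - binary (\<lambda>i. y (i + m)))"
    using assms by (subst (1 2) binary_split[of _ m]) (simp add: algebra_simps)
  moreover have "\<bar>binary (\<lambda>i. x (i + m)) - binary (\<lambda>i. y (i + m))\<bar> \<le> 1"
    using binary_bounds[of "\<lambda>i. x (i + m)"] binary_bounds[of "\<lambda>i. y (i + m)"] by linarith
  ultimately show ?thesis
    by (simp add: abs_mult mult_left_le)
qed

lemma binary_onto:
  assumes "0 \<le> r" "r < 1"
  obtains x where "binary x = r"
proof
  \<comment> \<open>These are the standard digits: their partial sums truncate \<open>r\<close>
    after \<open>m\<close> binary places.\<close>
  let ?x = "\<lambda>i. odd \<lfloor>2 ^ Suc i * r\<rfloor>"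
  have partial: "(\<Sum>i<m. of_bool (?x i) * (1/2 :: real) ^ Suc i) = of_int \<lfloor>2 ^ m * r\<rfloor> / 2 ^ m" for m
  proof (induction m)
    case 0
    \<comment> \<open>Both bounds on \<open>r\<close> enter here: digits after the point cannot
      account for an integer part.\<close>
    have "\<lfloor>r\<rfloor> = 0" using assms by (simp add: floor_eq_iff)
    then show ?case by simp
  next
    case (Suc m)
    \<comment> \<open>Halving before the floor is integer division after it, so the new digit is the
      remainder modulo 2.\<close>
    have "\<lfloor>2 ^ Suc m * r / of_int 2\<rfloor> = \<lfloor>2 ^ Suc m * r\<rfloor> div 2"
      by (rule floor_divide_real_eq_div) simp
    then have "\<lfloor>2 ^ m * r\<rfloor> = \<lfloor>2 ^ Suc m * r\<rfloor> div 2"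
      by simp
    then have "\<lfloor>2 ^ Suc m * r\<rfloor> = 2 * \<lfloor>2 ^ m * r\<rfloor> + of_bool (?x m)"
      by (metis mult_div_mod_eq mod_2_eq_odd)
    from arg_cong[OF this, of real_of_int]
    have "real_of_int \<lfloor>2 ^ Suc m * r\<rfloor> = 2 * of_int \<lfloor>2 ^ m * r\<rfloor> + of_bool (?x m)"
      by (simp only: of_int_add of_int_mult of_int_numeral of_int_of_bool)
    then have "of_int \<lfloor>2 ^ Suc m * r\<rfloor> / 2 ^ Suc m
        = of_int \<lfloor>2 ^ m * r\<rfloor> / 2 ^ m + of_bool (?x m) * (1/2 :: real) ^ Suc m"
      by (simp add: add_divide_distrib power_divide)
    then show ?case
      using Suc by (simp only: sum.lessThan_Suc)
  qed
  have "(\<lambda>m. of_int \<lfloor>2 ^ m * r\<rfloor> / 2 ^ m) \<longlonglongrightarrow> r"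
  proof (rule tendsto_sandwich[where f = "\<lambda>m. r - (1/2) ^ m" and h = "\<lambda>_. r"])
    show "\<forall>\<^sub>F m in sequentially. r - (1/2) ^ m \<le> of_int \<lfloor>2 ^ m * r\<rfloor> / 2 ^ m"
    proof (intro always_eventually allI)
      fix m
      have "2 ^ m * r - 1 \<le> of_int \<lfloor>2 ^ m * r\<rfloor>" by linarith
      then have "(2 ^ m * r - 1) / 2 ^ m \<le> of_int \<lfloor>2 ^ m * r\<rfloor> / 2 ^ m"
        by (rule divide_right_mono) simp
      then show "r - (1/2) ^ m \<le> of_int \<lfloor>2 ^ m * r\<rfloor> / 2 ^ m"
        by (simp add: diff_divide_distrib power_divide)
    qed
    show "\<forall>\<^sub>F m in sequentially. of_int \<lfloor>2 ^ m * r\<rfloor> / 2 ^ m \<le> r"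
      by (intro always_eventually allI) (simp add: pos_divide_le_eq mult.commute)
    have "(\<lambda>m. r - (1/2) ^ m) \<longlonglongrightarrow> r - 0"
      by (intro tendsto_intros LIMSEQ_realpow_zero) auto
    then show "(\<lambda>m. r - (1/2) ^ m) \<longlonglongrightarrow> r" by simp
  qed simp
  then have "(\<lambda>i. of_bool (?x i) * (1/2) ^ Suc i) sums r"
    unfolding sums_def partial .
  then show "binary ?x = r"
    unfolding binary_def by (rule sums_unique[symmetric])
qed

section \<open>Nowhere dense sets and initial segments of binary expansions\<close>

lemma nowhere_dense_avoid:
  assumes "nowhere_dense N" and "(a::real) < b"
  obtains c e where "a < c" "c < b" "0 < e" "ball c e \<inter> N = {}"
proof -
  have "\<not> {a<..<b} \<subseteq> closure N"
    using assms interior_maximal[of "{a<..<b}" "closure N"]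
    by (auto simp: nowhere_dense_def)
  then obtain c where c: "a < c" "c < b" "c \<in> - closure N"
    unfolding subset_iff greaterThanLessThan_iff Compl_iff by blast
  moreover have "open (- closure N)" by (intro open_Compl closed_closure)
  ultimately obtain e where "0 < e" "ball c e \<subseteq> - closure N"
    by (meson openE)
  then show ?thesis
    using that c closure_subset[of N] by blast
qed

text \<open>Fixing the first \<open>m\<close> digits leaves an interval of length
  \<open>(1/2) ^ m\<close> for the named reals. Some point of it has a ball around it that misses
  \<open>N\<close>; \<open>y\<close> names this point, and \<open>k\<close> common digits keep
  \<open>binary z\<close> within the ball.\<close>

lemma nowhere_dense_avoid_binary:
  assumes "nowhere_dense N"
  obtains y k where "\<forall>i<m. y i = x i" and "\<And>z. \<forall>i<k. z i = y i \<Longrightarrow> binary z \<notin> N"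
proof -
  let ?s = "\<Sum>i<m. of_bool (x i) * (1/2 :: real) ^ Suc i"
  obtain c e where c: "?s < c" "c < ?s + (1/2) ^ m" and e: "0 < e" "ball c e \<inter> N = {}"
    using nowhere_dense_avoid[OF assms, of ?s "?s + (1/2) ^ m"] by auto
  \<comment> \<open>Rescaling the interval to [0, 1) turns \<open>c\<close> into the real whose
    digits have to follow the prefix.\<close>
  have "0 \<le> (c - ?s) * 2 ^ m" "(c - ?s) * 2 ^ m < 1"
    using c by (auto simp: field_simps)
  then obtain w where w: "binary w = (c - ?s) * 2 ^ m"
    using binary_onto by blast
  define y where "y i = (if i < m then x i else w (i - m))" for i
  have "binary y = ?s + (1/2) ^ m * binary w"
    by (subst binary_split[of _ m]) (simp add: y_def)
  then have y: "binary y = c"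
    by (simp add: w field_simps)
  obtain k where k: "(1/2 :: real) ^ k < e"
    using real_arch_pow_inv[OF e(1), of "1/2"] by auto
  have "binary z \<notin> N" if "\<forall>i<k. z i = y i" for z
  proof -
    have "binary z \<in> ball c e"
      using binary_close[OF that] k y by (simp add: dist_real_def abs_minus_commute)
    then show ?thesis using e(2) by blast
  qed
  then show ?thesis
    using that[of y k] by (simp add: y_def)
qed

section \<open>The theory of singletons with propositional variables\<close>

definition prop_sig :: signature where
  "prop_sig = (\<lambda>_. Some 0)"

definition singleton_thy :: "fm set" where
  "singleton_thy = {Neg (Exists 0 (Exists 1 (Neg (Eq 0 1))))}"

text \<open>Truth in a one-element structure: equations hold and quantifiers have nothing to vary.
  The list \<open>vs\<close> is dropped because \<open>prop_sig\<close> admits only the empty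
  one.\<close>

fun prop_val :: "(nat \<Rightarrow> bool) \<Rightarrow> fm \<Rightarrow> bool" where
  "prop_val x (Rel r vs) \<longleftrightarrow> x r"
| "prop_val x (Eq i j) \<longleftrightarrow> True"
| "prop_val x (Neg \<phi>) \<longleftrightarrow> \<not> prop_val x \<phi>"
| "prop_val x (And \<phi> \<psi>) \<longleftrightarrow> prop_val x \<phi> \<and> prop_val x \<psi>"
| "prop_val x (Exists i \<phi>) \<longleftrightarrow> prop_val x \<phi>"

definition valuation :: "'u struct \<Rightarrow> nat \<Rightarrow> bool" where
  "valuation M r \<longleftrightarrow> [] \<in> interp M r"

definition truth_set :: "fm \<Rightarrow> (nat \<Rightarrow> bool) set" where
  "truth_set \<phi> = {x. prop_val x \<phi>}"

lemma singleton_thy: "Ln_theory 3 \<Sigma> singleton_thy"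
  by (auto simp: Ln_theory_def singleton_thy_def Ln_def)

text \<open>Updating \<open>s\<close> inside the universe keeps its values at \<open>a\<close>, so
  the induction passes through quantifiers. Only variables below \<open>n\<close> are constrained,
  since members of \<open>assignments\<close> are undefined elsewhere.\<close>

lemma sat_singleton:
  assumes "universe M = {a}" "Ln_fm n prop_sig \<phi>" "\<forall>i<n. s i = a"
  shows "sat M s \<phi> \<longleftrightarrow> prop_val (valuation M) \<phi>"
  using assms(2,3)
proof (induction \<phi> arbitrary: s)
  case (Exists i \<phi>)
  then show ?case using assms(1) by simp
qed (auto simp: prop_sig_def valuation_def)

lemma model_singleton:
  assumes "is_model 3 M singleton_thy"
  obtains a where "universe M = {a}"
proof -
  obtain a where a: "a \<in> universe M"
    using assms by (auto simp: is_model_def)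
  obtain s where "s \<in> assignments 3 M"
    using assms assignments_nonempty[of M 3] by (auto simp: is_model_def)
  then have "\<forall>b\<in>universe M. \<forall>c\<in>universe M. b = c"
    using assms by (auto simp: is_model_def singleton_thy_def)
  then show ?thesis
    using that a by blast
qed

lemma sat_model_singleton:
  assumes "is_model 3 M singleton_thy" "s \<in> assignments 3 M" "\<phi> \<in> Ln 3 prop_sig"
  shows "sat M s \<phi> \<longleftrightarrow> prop_val (valuation M) \<phi>"
proof -
  obtain a where a: "universe M = {a}"
    using model_singleton[OF assms(1)] .
  moreover have "\<forall>i<3. s i = a"
    using assms(2) a by (auto simp: assignments_def PiE_def Pi_def)
  ultimately show ?thesis
    using sat_singleton[OF a] assms(3) by (simp add: Ln_def)
qed

lemma valuation_model:
  obtains M :: "'u struct" and s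
  where "is_model 3 M singleton_thy" "s \<in> assignments 3 M" "valuation M = x"
proof -
  let ?M = "\<lparr>universe = {undefined}, interp = \<lambda>r. if x r then {[]} else {}\<rparr> :: 'u struct"
  have "is_model 3 ?M singleton_thy"
    by (auto simp: is_model_def singleton_thy_def)
  moreover from this obtain s where "s \<in> assignments 3 ?M"
    using assignments_nonempty[of ?M 3] by (auto simp: is_model_def)
  moreover have "valuation ?M = x"
    by (simp add: fun_eq_iff valuation_def)
  ultimately show ?thesis
    using that by blast
qed

text \<open>Every model has a valuation and every valuation comes from a model, so modulo this
  theory the logic is propositional, whatever the type \<open>'u\<close>.\<close>

lemma consistent_with_iff_truth_set:
  assumes "\<phi> \<in> Ln 3 prop_sig"
  shows "consistent_with TYPE('u) 3 singleton_thy \<phi> \<longleftrightarrow> truth_set \<phi> \<noteq> {}"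
proof
  show "truth_set \<phi> \<noteq> {}" if "consistent_with TYPE('u) 3 singleton_thy \<phi>"
    using that sat_model_singleton assms
    by (fastforce simp: consistent_with_def truth_set_def)
next
  assume "truth_set \<phi> \<noteq> {}"
  then obtain x where x: "prop_val x \<phi>"
    by (auto simp: truth_set_def)
  obtain M :: "'u struct" and s
    where M: "is_model 3 M singleton_thy" "s \<in> assignments 3 M" "valuation M = x"
    using valuation_model by blast
  then show "consistent_with TYPE('u) 3 singleton_thy \<phi>"
    unfolding consistent_with_def using sat_model_singleton[OF M(1,2) assms] x by blast
qed

lemma truth_set_simps [simp]:
  "truth_set (Eq i j) = UNIV"
  "truth_set (Neg \<phi>) = - truth_set \<phi>"
  "truth_set (And \<phi> \<psi>) = truth_set \<phi> \<inter> truth_set \<psi>"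
  "truth_set (Exists i \<phi>) = truth_set \<phi>"
  by (auto simp: truth_set_def)

lemma truth_set_Or [simp]: "truth_set (Or \<phi> \<psi>) = truth_set \<phi> \<union> truth_set \<psi>"
  by (simp add: Or_def)

lemma entails_Imp_iff:
  assumes "\<phi> \<in> Ln 3 prop_sig" "\<psi> \<in> Ln 3 prop_sig"
  shows "entails TYPE('u) 3 singleton_thy (Imp \<phi> \<psi>) \<longleftrightarrow> truth_set \<phi> \<subseteq> truth_set \<psi>"
proof -
  have "Neg (Imp \<phi> \<psi>) \<in> Ln 3 prop_sig"
    using assms by (simp add: in_Ln_simps)
  then have "entails TYPE('u) 3 singleton_thy (Imp \<phi> \<psi>) \<longleftrightarrow> truth_set (Neg (Imp \<phi> \<psi>)) = {}"
    unfolding entails_iff by (simp add: consistent_with_iff_truth_set del: truth_set_simps)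
  then show ?thesis by (auto simp: Imp_def)
qed

lemma consistent_singleton_thy: "consistent TYPE('u) 3 singleton_thy"
  by (simp add: consistent_iff consistent_with_iff_truth_set in_Ln_simps)

section \<open>The Tarski--Lindenbaum algebra as a neat reduct\<close>

lemma TL_rel_singleton:
  "TL_rel TYPE('u) 3 prop_sig singleton_thy
    = {(\<phi>, \<psi>). \<phi> \<in> Ln 3 prop_sig \<and> \<psi> \<in> Ln 3 prop_sig \<and> truth_set \<phi> = truth_set \<psi>}"
proof -
  have "entails TYPE('u) 3 singleton_thy (Iff \<phi> \<psi>) \<longleftrightarrow> truth_set \<phi> = truth_set \<psi>"
    if "\<phi> \<in> Ln 3 prop_sig" "\<psi> \<in> Ln 3 prop_sig" for \<phi> \<psi>
  proof -
    have "entails TYPE('u) 3 singleton_thy (Iff \<phi> \<psi>) \<longleftrightarrow>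
        entails TYPE('u) 3 singleton_thy (Imp \<phi> \<psi>) \<and> entails TYPE('u) 3 singleton_thy (Imp \<psi> \<phi>)"
      by (auto simp: entails_def Iff_def)
    then show ?thesis
      using that by (auto simp: entails_Imp_iff)
  qed
  then show ?thesis by (auto simp: TL_rel_def)
qed

text \<open>These are the clopen subsets of the Cantor space; cylindrifications are the identity and
  diagonals the unit at all indices, including those from 3 on.\<close>

definition truth_alg :: "(nat \<Rightarrow> bool) set cyl_alg" where
  "truth_alg = \<lparr>ca_carrier = truth_set ` Ln 3 prop_sig, ca_join = (\<union>), ca_meet = (\<inter>),
     ca_compl = uminus, ca_zero = {}, ca_one = UNIV, cyl = \<lambda>i X. X, diag = \<lambda>i j. UNIV\<rparr>"

lemma truth_alg_CA: "CA_omega truth_alg"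
proof -
  let ?C = "truth_set ` Ln 3 prop_sig"
  have one: "UNIV \<in> ?C"
    by (rule image_eqI[where x = "Eq 0 0"]) (auto simp: Ln_def)
  have zero: "{} \<in> ?C"
    by (rule image_eqI[where x = "Neg (Eq 0 0)"]) (auto simp: Ln_def)
  have compl: "- X \<in> ?C" if X: "X \<in> ?C" for X
  proof -
    obtain \<phi> where "\<phi> \<in> Ln 3 prop_sig" "X = truth_set \<phi>" using X by blast
    then show ?thesis by (intro image_eqI[where x = "Neg \<phi>"]) (auto simp: Ln_def)
  qed
  have meet: "X \<inter> Y \<in> ?C" if XY: "X \<in> ?C" "Y \<in> ?C" for X Y
  proof -
    obtain \<phi> \<psi> where "\<phi> \<in> Ln 3 prop_sig" "X = truth_set \<phi>" "\<psi> \<in> Ln 3 prop_sig" "Y = truth_set \<psi>"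
      using XY by blast
    then show ?thesis by (intro image_eqI[where x = "And \<phi> \<psi>"]) (auto simp: Ln_def)
  qed
  have join: "X \<union> Y \<in> ?C" if XY: "X \<in> ?C" "Y \<in> ?C" for X Y
    using compl[OF meet[OF compl compl], OF XY] by simp
  \<comment> \<open>With these cylindrifications and diagonals each cylindric axiom becomes a
    Boolean identity.\<close>
  show ?thesis
    by unfold_locales (auto simp: truth_alg_def one zero compl meet join)
qed

text \<open>Equivalent formulas share their truth set, so the union over a class is that common set.
  The neat reduct is all of \<open>truth_alg\<close>, since every cylindrification fixes every
  element.\<close>

lemma TL_alg_singleton_iso:
  "cyl_iso 3 (TL_alg TYPE('u) 3 prop_sig singleton_thy) (neat_reduct 3 truth_alg)
     (\<lambda>X. \<Union> (truth_set ` X))"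
proof -
  define L where "L = Ln 3 prop_sig"
  define E where "E = TL_rel TYPE('u) 3 prop_sig singleton_thy"
  define h where "h X = \<Union> (truth_set ` X)" for X
  have E: "E = {(\<phi>, \<psi>). \<phi> \<in> L \<and> \<psi> \<in> L \<and> truth_set \<phi> = truth_set \<psi>}"
    by (simp add: E_def TL_rel_singleton L_def)
  have hE: "h (E `` {\<phi>}) = truth_set \<phi>" if "\<phi> \<in> L" for \<phi>
    using that by (auto simp: h_def E)
  have hUN: "h (\<Union>\<phi>\<in>X. F \<phi>) = (\<Union>\<phi>\<in>X. h (F \<phi>))" for F and X :: "fm set"
    by (auto simp: h_def)
  have rep: "\<exists>\<phi>\<in>L. X = E `` {\<phi>}" if "X \<in> L // E" for X
    using that by (auto simp: quotient_def)
  have cls: "X \<noteq> {}" "X \<subseteq> L" "\<forall>\<phi>\<in>X. truth_set \<phi> = h X" if X: "X \<in> L // E" for X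
  proof -
    obtain \<phi> where "\<phi> \<in> L" "X = E `` {\<phi>}" using rep[OF X] by blast
    then show "X \<noteq> {}" "X \<subseteq> L" "\<forall>\<phi>\<in>X. truth_set \<phi> = h X"
      using hE by (auto simp: E)
  qed
  have L: "Neg \<phi> \<in> L \<longleftrightarrow> \<phi> \<in> L" "And \<phi> \<psi> \<in> L \<longleftrightarrow> \<phi> \<in> L \<and> \<psi> \<in> L"
    "Or \<phi> \<psi> \<in> L \<longleftrightarrow> \<phi> \<in> L \<and> \<psi> \<in> L" "Exists i \<phi> \<in> L \<longleftrightarrow> i < 3 \<and> \<phi> \<in> L"
    "Eq i j \<in> L \<longleftrightarrow> i < 3 \<and> j < 3" for \<phi> \<psi> i j
    by (auto simp: L_def Ln_def Or_def)
  \<comment> \<open>All representatives give terms with the same image under \<open>h\<close>; as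
    classes are nonempty, the union collapses to that value.\<close>
  have binary_op: "h (\<Union>\<phi>\<in>X. \<Union>\<psi>\<in>Y. E `` {C \<phi> \<psi>}) = G (h X) (h Y)"
    if XY: "X \<in> L // E" "Y \<in> L // E"
      and C: "\<And>\<phi> \<psi>. \<lbrakk>\<phi> \<in> L; \<psi> \<in> L\<rbrakk> \<Longrightarrow> C \<phi> \<psi> \<in> L"
        "\<And>\<phi> \<psi>. truth_set (C \<phi> \<psi>) = G (truth_set \<phi>) (truth_set \<psi>)"
    for X Y C G
  proof -
    have "h (E `` {C \<phi> \<psi>}) = G (h X) (h Y)" if "\<phi> \<in> X" "\<psi> \<in> Y" for \<phi> \<psi>
    proof -
      have "\<phi> \<in> L" "\<psi> \<in> L" "truth_set \<phi> = h X" "truth_set \<psi> = h Y"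
        using that cls XY by blast+
      then show ?thesis by (simp add: hE C)
    qed
    then show ?thesis
      using cls(1)[OF XY(1)] cls(1)[OF XY(2)] by (simp add: hUN)
  qed
  have unary_op: "h (\<Union>\<phi>\<in>X. E `` {C \<phi>}) = G (h X)"
    if X: "X \<in> L // E" and C: "\<And>\<phi>. \<phi> \<in> L \<Longrightarrow> C \<phi> \<in> L" "\<And>\<phi>. truth_set (C \<phi>) = G (truth_set \<phi>)"
    for X C G
  proof -
    have "h (E `` {C \<phi>}) = G (h X)" if "\<phi> \<in> X" for \<phi>
    proof -
      have "\<phi> \<in> L" "truth_set \<phi> = h X"
        using that cls X by blast+
      then show ?thesis by (simp add: hE C)
    qed
    then show ?thesis
      using cls(1)[OF X] by (simp add: hUN)
  qed
  have "inj_on h (L // E)"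
  proof (rule inj_onI)
    fix X Y assume XY: "X \<in> L // E" "Y \<in> L // E" "h X = h Y"
    obtain \<phi> \<psi> where "\<phi> \<in> L" "X = E `` {\<phi>}" "\<psi> \<in> L" "Y = E `` {\<psi>}"
      using rep XY by meson
    moreover from this have "truth_set \<phi> = truth_set \<psi>" using hE XY(3) by simp
    ultimately show "X = Y" by (auto simp: E)
  qed
  moreover have "h ` (L // E) = truth_set ` L"
  proof -
    have "L // E = (\<lambda>\<phi>. E `` {\<phi>}) ` L"
      by (auto simp: quotient_def)
    then show ?thesis
      using hE by (simp add: image_image)
  qed
  ultimately have bij: "bij_betw h (L // E) (truth_set ` L)"
    by (simp add: bij_betw_def)
  have "cyl_iso 3 (TL_alg TYPE('u) 3 prop_sig singleton_thy) (neat_reduct 3 truth_alg) h"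
    unfolding cyl_iso_def TL_alg_def Let_def neat_reduct_def truth_alg_def
      E_def[symmetric] L_def[symmetric] cyl_alg.simps
    using bij
    by (auto simp: L hE binary_op[where C = Or and G = "(\<union>)"]
        binary_op[where C = And and G = "(\<inter>)"] unary_op[where C = Neg and G = uminus]
        unary_op[where C = "Exists i" and G = "\<lambda>X. X" for i])
  then show ?thesis by (simp add: h_def[abs_def])
qed

text \<open>The algebra \<open>truth_alg\<close> lives on sets of valuations, whence the first type
  argument.\<close>

lemma singleton_thy_neat:
  "in_Nr_CA_omega TYPE((nat \<Rightarrow> bool) set) 3 (TL_alg TYPE('u) 3 prop_sig singleton_thy)"
  unfolding in_Nr_CA_omega_def using truth_alg_CA TL_alg_singleton_iso by blast

section \<open>Types from nowhere dense sets\<close>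

definition nwd_type :: "real set \<Rightarrow> fm set" where
  "nwd_type N = {\<phi> \<in> Ln 3 prop_sig. binary -` N \<subseteq> truth_set \<phi>}"

text \<open>A formula mentions finitely many symbols, so its truth set is clopen.\<close>

lemma prop_val_finite: "\<exists>m. \<forall>x y. (\<forall>i<m. x i = y i) \<longrightarrow> prop_val x \<phi> = prop_val y \<phi>"
proof (induction \<phi>)
  case (Rel r vs)
  then show ?case by (intro exI[of _ "Suc r"]) auto
next
  case (And \<phi> \<psi>)
  then obtain m k where m: "\<And>x y. \<forall>i<m. x i = y i \<Longrightarrow> prop_val x \<phi> = prop_val y \<phi>"
    and k: "\<And>x y. \<forall>i<k. x i = y i \<Longrightarrow> prop_val x \<psi> = prop_val y \<psi>"
    by blast
  show ?case
  proof (intro exI allI impI)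
    fix x y :: "nat \<Rightarrow> bool"
    assume "\<forall>i<max m k. x i = y i"
    then show "prop_val x (And \<phi> \<psi>) = prop_val y (And \<phi> \<psi>)"
      using m[of x y] k[of x y] by simp
  qed
qed auto

text \<open>A conjunction of \<open>k\<close> literals defines the basic clopen set around
  \<open>y\<close>.\<close>

lemma cylinder_formula:
  "\<exists>\<phi>\<in>Ln 3 prop_sig. truth_set \<phi> = {x. \<forall>i<k. x i = y i}"
proof (induction k)
  case 0
  then show ?case by (intro bexI[of _ "Eq 0 0"]) (auto simp: Ln_def)
next
  case (Suc k)
  then obtain \<phi> where \<phi>: "\<phi> \<in> Ln 3 prop_sig" "truth_set \<phi> = {x. \<forall>i<k. x i = y i}"
    by blast
  let ?\<psi> = "And \<phi> (if y k then Rel k [] else Neg (Rel k []))"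
  have "?\<psi> \<in> Ln 3 prop_sig"
    using \<phi>(1) by (simp add: Ln_def prop_sig_def)
  moreover have "truth_set ?\<psi> = {x. \<forall>i<Suc k. x i = y i}"
    using \<phi>(2) by (cases "y k") (auto simp: truth_set_def less_Suc_eq)
  ultimately show ?case by (rule bexI[rotated])
qed

text \<open>A supposed isolating \<open>\<psi>\<close> depends on finitely many digits, so it holds
  at some \<open>y\<close> with a basic clopen neighbourhood whose points name no element of
  \<open>N\<close>. The negated formula of that neighbourhood is in the type but fails at
  \<open>y\<close>.\<close>

lemma nwd_type_non_principal:
  assumes "nowhere_dense N"
  shows "non_principal TYPE('u) 3 prop_sig singleton_thy (nwd_type N)"
  unfolding non_principal_def
proof (intro notI, elim bexE conjE)
  fix \<psi>
  assume \<psi>: "\<psi> \<in> Ln 3 prop_sig"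
    and con: "consistent_with TYPE('u) 3 singleton_thy \<psi>"
    and ent: "\<forall>\<phi>\<in>nwd_type N. entails TYPE('u) 3 singleton_thy (Imp \<psi> \<phi>)"
  have sub: "truth_set \<psi> \<subseteq> truth_set \<phi>" if "\<phi> \<in> nwd_type N" for \<phi>
    using ent that \<psi> entails_Imp_iff unfolding nwd_type_def by blast
  obtain x where x: "prop_val x \<psi>"
    using con consistent_with_iff_truth_set[OF \<psi>] by (auto simp: truth_set_def)
  obtain m where m: "\<And>x y. \<forall>i<m. x i = y i \<Longrightarrow> prop_val x \<psi> = prop_val y \<psi>"
    using prop_val_finite by blast
  obtain y k where y: "\<forall>i<m. y i = x i" and k: "\<And>z. \<forall>i<k. z i = y i \<Longrightarrow> binary z \<notin> N"
    using nowhere_dense_avoid_binary[OF assms] by blast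
  obtain \<phi> where \<phi>: "\<phi> \<in> Ln 3 prop_sig" "truth_set \<phi> = {z. \<forall>i<k. z i = y i}"
    using cylinder_formula[of k y] by blast
  have "Neg \<phi> \<in> nwd_type N"
    using \<phi> k by (auto simp: nwd_type_def in_Ln_simps)
  then have "truth_set \<psi> \<subseteq> - truth_set \<phi>"
    using sub by fastforce
  moreover have "y \<in> truth_set \<psi>" using m[OF y] x by (simp add: truth_set_def)
  moreover have "y \<in> truth_set \<phi>" using \<phi>(2) by simp
  ultimately show False by blast
qed

section \<open>Covering families yield types that cannot all be omitted\<close>

lemma not_OTT_if_nwd_coverable:
  assumes inf: "infinite (UNIV :: 'u set)" and cov: "nwd_coverable \<kappa>"
  shows "\<not> OTT TYPE('u) \<kappa>"
proof
  assume "OTT TYPE('u) \<kappa>"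
  \<comment> \<open>The neat reduct is available over this type, so the statement is first moved to
    it.\<close>
  moreover have "infinite (UNIV :: (nat \<Rightarrow> bool) set set)"
    using finite_fun_UNIVD1[where 'a = nat and 'b = bool] by (auto simp: Finite_Set.finite_set)
  ultimately have O: "OTT TYPE((nat \<Rightarrow> bool) set) \<kappa>"
    using OTT_mono[OF inf] by blast
  obtain N where N: "\<forall>k\<in>Field \<kappa>. nowhere_dense (N k)" "(\<Union>k\<in>Field \<kappa>. N k) = (UNIV :: real set)"
    using cov unfolding nwd_coverable_def by blast
  have "\<forall>k\<in>Field \<kappa>. nwd_type (N k) \<subseteq> Ln 3 prop_sig \<and>
      non_principal TYPE((nat \<Rightarrow> bool) set) 3 prop_sig singleton_thy (nwd_type (N k))"
    using N(1) nwd_type_non_principal by (auto simp: nwd_type_def)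
  then obtain M :: "(nat \<Rightarrow> bool) set struct"
    where M: "is_model 3 M singleton_thy" "\<forall>k\<in>Field \<kappa>. omits 3 M (nwd_type (N k))"
    using O[unfolded OTT_def, rule_format, of 3 prop_sig singleton_thy "\<lambda>k. nwd_type (N k)"]
      singleton_thy consistent_singleton_thy singleton_thy_neat by auto
  obtain s where s: "s \<in> assignments 3 M"
    using M(1) assignments_nonempty[of M 3] by (auto simp: is_model_def)
  \<comment> \<open>The cover catches the real named by \<open>M\<close>; the type with that index
    is realized in \<open>M\<close>.\<close>
  obtain k where k: "k \<in> Field \<kappa>" "binary (valuation M) \<in> N k"
    using N(2) by blast
  have "sat M s \<phi>" if "\<phi> \<in> nwd_type (N k)" for \<phi>
    using that k(2) sat_model_singleton[OF M(1) s] by (auto simp: nwd_type_def truth_set_def)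
  then show False
    using M(2) k(1) s unfolding omits_def by blast
qed

text \<open>The minimum is attained by \<open>covK_spec\<close>: \<open>covK\<close> itself indexes
  a cover of the line.\<close>

theorem theorem5p18:
  assumes "infinite (UNIV :: 'u set)"
  shows "\<not> OTT TYPE('u) covK"
  using not_OTT_if_nwd_coverable[OF assms] covK_spec by blast

end
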